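(* Let $H$ be a real Hilbert space, $C\subseteq H$ a nonempty convex subset, $0\leq\kappa<1$, and let $T:C\to C$ be a $\kappa$-strict pseudo-contraction. Let $(\lambda_n)_{n\in\mathbb{N}}$ be a sequence in $(\kappa,1)$ such that $\sum_{n=0}^\infty(\lambda_n-\kappa)(1-\lambda_n)=\infty$ with rate of divergence $\theta:\mathbb{N}\to\mathbb{N}$. Let $x\in C$ and $b>0$ be such that $\|x-Tx\|\leq b$ and $T$ has approximate fixed points in a $b$-neighborhood of $x$. Let $(x_n)$ be the Mann iteration starting with $x$, that is, $x_0:=x$ and $x_{n+1}:=\lambda_n x_n+(1-\lambda_n)Tx_n$ for all $n\in\mathbb{N}$. Then $\lim_{n\to\infty}\|x_n-Tx_n\|=0$ and, moreover, for every $\varepsilon>0$ and every $n\geq\Phi(\varepsilon,b,\theta)$ one has $\|x_n-Tx_n\|<\varepsilon$, where $$\Phi(\varepsilon,b,\theta)=\theta\left(\left\lceil\frac{b^2}{\varepsilon^2}\right\rceil\right).$$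
   Context: $\mathbb{N}=\{0,1,2,\dots\}$. For $0\leq\kappa<1$, a mapping $T:C\to C$ is a $\kappa$-strict pseudo-contraction if for all $u,v\in C$, $\|Tu-Tv\|^2\leq\|u-v\|^2+\kappa\|u-Tu-(v-Tv)\|^2$. $T$ has approximate fixed points in a $b$-neighborhood of $x$ if for every $\delta>0$ there exists $y\in C$ with $\|x-y\|\leq b$ and $\|y-Ty\|<\delta$. A rate of divergence for a divergent series $\sum_{n=0}^\infty a_n$ is a mapping $\theta:\mathbb{N}\to\mathbb{N}$ satisfying $\sum_{k=0}^{\theta(n)}a_k\geq n$ for all $n\in\mathbb{N}$. *)

theory Defs
  imports "HOL-Analysis.Analysis"
begin

definition strict_pseudo_contraction ::
  "real \<Rightarrow> 'a::real_inner set \<Rightarrow> ('a \<Rightarrow> 'a) \<Rightarrow> bool" where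
  "strict_pseudo_contraction \<kappa> C T \<longleftrightarrow>
     0 \<le> \<kappa> \<and> \<kappa> < 1 \<and> T \<in> C \<rightarrow> C \<and>
     (\<forall>u\<in>C. \<forall>v\<in>C.
        (norm (T u - T v))\<^sup>2 \<le> (norm (u - v))\<^sup>2 + \<kappa> * (norm (u - T u - (v - T v)))\<^sup>2)"

definition has_approx_fixed_points ::
  "'a::real_normed_vector set \<Rightarrow> ('a \<Rightarrow> 'a) \<Rightarrow> 'a \<Rightarrow> real \<Rightarrow> bool" where
  "has_approx_fixed_points C T x b \<longleftrightarrow>
     (\<forall>\<delta>>0. \<exists>y\<in>C. norm (x - y) \<le> b \<and> norm (y - T y) < \<delta>)"

definition rate_of_divergence :: "(nat \<Rightarrow> real) \<Rightarrow> (nat \<Rightarrow> nat) \<Rightarrow> bool" where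
  "rate_of_divergence a \<theta> \<longleftrightarrow> (\<forall>n. (\<Sum>k=0..\<theta> n. a k) \<ge> real n)"

primrec mann :: "('a::real_vector \<Rightarrow> 'a) \<Rightarrow> (nat \<Rightarrow> real) \<Rightarrow> 'a \<Rightarrow> nat \<Rightarrow> 'a" where
  "mann T l x 0 = x"
| "mann T l x (Suc n) = l n *\<^sub>R mann T l x n + (1 - l n) *\<^sub>R T (mann T l x n)"

definition Phi :: "real \<Rightarrow> real \<Rightarrow> (nat \<Rightarrow> nat) \<Rightarrow> nat" where
  "Phi \<epsilon> b \<theta> = \<theta> (nat \<lceil>b\<^sup>2 / \<epsilon>\<^sup>2\<rceil>)"

end

theory Submission
  imports Defs
begin

text \<open>
  The averaged map \<open>S = \<kappa> I + (1 - \<kappa>) T\<close> is nonexpansive, and the Mann iteration of \<open>T\<close> is a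
  Mann iteration of \<open>S\<close> with weights \<open>(l n - \<kappa>) / (1 - \<kappa>)\<close>; this reduces everything to \<open>\<kappa> = 0\<close>.
  There the residuals \<open>\<parallel>y n - S (y n)\<parallel>\<close> decrease, and comparing the squared distances to an
  approximate fixed point \<open>p\<close> gives \<open>(\<Sum>k\<le>n. m k (1 - m k)) \<parallel>y n - S (y n)\<parallel>\<^sup>2 \<le> b\<^sup>2\<close>.

  The rate needs this inequality to be strict, because \<open>b\<^sup>2 / \<epsilon>\<^sup>2\<close> may be an integer. If the residual
  norm strictly decreases in the last step, strictness is clear. Otherwise the equality case of the
  triangle inequality shows that the last two residuals coincide as vectors \<open>v\<close>; then \<open>p\<close>
  lies beyond the midpoint of \<open>y n\<close> and \<open>S (y n) = y n - v\<close> in direction \<open>-v\<close>, so the last steps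
  bring the iteration closer to \<open>p\<close> than the general estimate guarantees.
\<close>

section \<open>Squared norms, equality in the triangle inequality, vanishing errors\<close>

lemma norm_affine_combination_square:
  fixes a b :: "'a::real_inner"
  shows "(norm (t *\<^sub>R a + (1 - t) *\<^sub>R b))\<^sup>2
    = t * (norm a)\<^sup>2 + (1 - t) * (norm b)\<^sup>2 - t * (1 - t) * (norm (a - b))\<^sup>2"
  unfolding power2_norm_eq_inner
  by (simp add: inner_add_left inner_add_right inner_diff_left inner_diff_right inner_commute
      algebra_simps power2_eq_square)

text \<open>The lengths of the two summands add up to at most \<open>norm v\<close>, so a sum of
  that norm forces them to be aligned and \<open>d\<close> to have full length. Expanding squares
  turns this into a nonpositive squared distance between \<open>d\<close> and
  \<open>(1 - t) *\<^sub>R v\<close>.\<close>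

lemma triangle_equality_scaled:
  fixes v d :: "'a::real_inner"
  assumes t: "0 < t" "t < 1"
    and d: "norm d \<le> (1 - t) * norm v"
    and eq: "norm (t *\<^sub>R v + d) = norm v"
  shows "d = (1 - t) *\<^sub>R v"
proof -
  have d2: "(norm d)\<^sup>2 \<le> (1 - t)\<^sup>2 * (norm v)\<^sup>2"
    using power_mono[OF d, of 2] by (simp add: power_mult_distrib)
  have "(norm (t *\<^sub>R v + d))\<^sup>2 = t\<^sup>2 * (norm v)\<^sup>2 + 2 * t * (v \<bullet> d) + (norm d)\<^sup>2"
    unfolding power2_norm_eq_inner
    by (simp add: inner_add_left inner_add_right inner_commute algebra_simps power2_eq_square)
  then have "2 * t * (v \<bullet> d) = (1 - t\<^sup>2) * (norm v)\<^sup>2 - (norm d)\<^sup>2"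
    using eq by (simp add: algebra_simps)
  also have "\<dots> \<ge> (1 - t\<^sup>2) * (norm v)\<^sup>2 - (1 - t)\<^sup>2 * (norm v)\<^sup>2"
    using d2 by simp
  also have "(1 - t\<^sup>2) * (norm v)\<^sup>2 - (1 - t)\<^sup>2 * (norm v)\<^sup>2 = 2 * t * ((1 - t) * (norm v)\<^sup>2)"
    by (simp add: algebra_simps power2_eq_square)
  finally have "(1 - t) * (norm v)\<^sup>2 \<le> v \<bullet> d"
    using t by simp
  then have vd: "(1 - t) * ((1 - t) * (norm v)\<^sup>2) \<le> (1 - t) * (v \<bullet> d)"
    using t by (intro mult_left_mono) auto
  have "(norm (d - (1 - t) *\<^sub>R v))\<^sup>2 = (norm d)\<^sup>2 - 2 * ((1 - t) * (v \<bullet> d)) + (1 - t)\<^sup>2 * (norm v)\<^sup>2"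
    unfolding power2_norm_eq_inner
    by (simp add: inner_diff_left inner_diff_right inner_commute algebra_simps power2_eq_square)
  also have "\<dots> \<le> 0"
    using d2 vd by (simp add: power2_eq_square algebra_simps)
  finally show ?thesis
    by simp
qed

text \<open>Removes the error caused by approximate fixed points: \<open>K\<close> is fixed while
  \<delta> tends to 0. The restriction \<delta> \<le> 1 allows quadratic errors to be bounded
  linearly.\<close>

lemma le_if_le_plus_small_multiples:
  fixes X Y K :: real
  assumes "\<And>\<delta>. 0 < \<delta> \<Longrightarrow> \<delta> \<le> 1 \<Longrightarrow> X \<le> Y + K * \<delta>"
  shows "X \<le> Y"
proof (rule tendsto_lowerbound)
  show "((\<lambda>\<delta>. Y + K * \<delta>) \<longlongrightarrow> Y) (at_right 0)"
    by (auto intro!: tendsto_eq_intros)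
  show "\<forall>\<^sub>F \<delta> in at_right 0. X \<le> Y + K * \<delta>"
    using assms by (auto simp: eventually_at_right_field intro!: exI[of _ 1])
qed simp

section \<open>Monotone residuals of the Mann iteration of a nonexpansive map\<close>

locale nonexpansive_mann =
  fixes C :: "'a::real_inner set" and S :: "'a \<Rightarrow> 'a" and m :: "nat \<Rightarrow> real" and x :: 'a
  assumes convex_C: "convex C"
    and S_in: "u \<in> C \<Longrightarrow> S u \<in> C"
    and nonexpansive: "u \<in> C \<Longrightarrow> v \<in> C \<Longrightarrow> norm (S u - S v) \<le> norm (u - v)"
    and m_pos: "0 < m n" and m_less_1: "m n < 1"
    and x_in: "x \<in> C"
begin

abbreviation y :: "nat \<Rightarrow> 'a" where "y \<equiv> mann S m x"

abbreviation weight :: "nat \<Rightarrow> real" where "weight n \<equiv> m n * (1 - m n)"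

abbreviation residual :: "nat \<Rightarrow> 'a" where "residual n \<equiv> y n - S (y n)"

lemma y_in: "y n \<in> C"
proof (induction n)
  case (Suc n)
  then show ?case
    using convexD[OF convex_C Suc S_in[OF Suc], of "m n" "1 - m n"] m_pos[of n] m_less_1[of n]
    by simp
qed (simp add: x_in)

lemma weight_pos: "0 < weight n"
  using m_pos m_less_1 by simp

lemma weight_le_quarter: "weight n \<le> 1 / 4"
proof -
  have "0 \<le> (m n - 1 / 2)\<^sup>2"
    by simp
  then show ?thesis
    by (simp add: power2_eq_square algebra_simps)
qed

lemma y_diff_Suc: "y n - y (Suc n) = (1 - m n) *\<^sub>R residual n"
  by (simp add: algebra_simps)

lemma residual_Suc: "residual (Suc n) = m n *\<^sub>R residual n + (S (y n) - S (y (Suc n)))"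
  by (simp add: algebra_simps)

lemma norm_S_diff_Suc_le: "norm (S (y n) - S (y (Suc n))) \<le> (1 - m n) * norm (residual n)"
proof -
  have "norm (S (y n) - S (y (Suc n))) \<le> norm (y n - y (Suc n))"
    by (rule nonexpansive[OF y_in y_in])
  then show ?thesis
    using m_less_1[of n] unfolding y_diff_Suc by simp
qed

text \<open>By \<open>residual_Suc\<close>, the new residual is \<open>m n\<close> times the old one
  plus a vector that nonexpansiveness bounds by the remaining fraction
  \<open>1 - m n\<close>.\<close>

lemma norm_residual_Suc_le: "norm (residual (Suc n)) \<le> norm (residual n)"
proof -
  have "norm (residual (Suc n)) \<le> norm (m n *\<^sub>R residual n) + norm (S (y n) - S (y (Suc n)))"
    unfolding residual_Suc by (rule norm_triangle_ineq)
  also have "\<dots> \<le> m n * norm (residual n) + (1 - m n) * norm (residual n)"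
    using norm_S_diff_Suc_le[of n] m_pos[of n] by simp
  finally show ?thesis
    by (simp add: algebra_simps)
qed

lemma norm_residual_antimono: "k \<le> n \<Longrightarrow> norm (residual n) \<le> norm (residual k)"
  using norm_residual_Suc_le by (rule lift_Suc_antimono_le)

text \<open>Equality of the norms makes the triangle inequality behind
  \<open>norm_residual_Suc_le\<close> sharp, and then \<open>triangle_equality_scaled\<close>
  identifies the second summand.\<close>

lemma residual_Suc_eq:
  assumes "norm (residual (Suc n)) = norm (residual n)"
  shows "residual (Suc n) = residual n"
proof -
  have "S (y n) - S (y (Suc n)) = (1 - m n) *\<^sub>R residual n"
    using assms unfolding residual_Suc
    by (intro triangle_equality_scaled m_pos m_less_1 norm_S_diff_Suc_le)
  then show ?thesis
    unfolding residual_Suc by (simp add: algebra_simps)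
qed

section \<open>Distances to an approximate fixed point\<close>

lemma norm_S_diff_approx_le:
  assumes "p \<in> C" "norm (p - S p) \<le> \<delta>"
  shows "norm (S (y n) - p) \<le> norm (y n - p) + \<delta>"
proof -
  have "norm (S (y n) - p) \<le> norm (S (y n) - S p) + norm (S p - p)"
    using norm_triangle_ineq[of "S (y n) - S p" "S p - p"] by simp
  then show ?thesis
    using nonexpansive[OF y_in assms(1), of n] assms(2) by (simp add: norm_minus_commute)
qed

text \<open>As \<open>p\<close> is only approximately fixed, each step may increase the distance by
  up to \<delta>. This crude bound controls the cross term that appears on squaring.\<close>

lemma norm_diff_approx_le:
  fixes b \<delta> :: real
  assumes p: "p \<in> C" "norm (p - S p) \<le> \<delta>" and "norm (x - p) \<le> b"
  shows "norm (y n - p) \<le> b + n * \<delta>"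
proof (induction n)
  case (Suc n)
  have \<delta>: "0 \<le> \<delta>"
    using p(2) norm_ge_zero order_trans by blast
  have "y (Suc n) - p = m n *\<^sub>R (y n - p) + (1 - m n) *\<^sub>R (S (y n) - p)"
    by (simp add: algebra_simps)
  also have "norm \<dots> \<le> m n * norm (y n - p) + (1 - m n) * norm (S (y n) - p)"
    using m_pos[of n] m_less_1[of n] by (intro norm_triangle_le) simp
  also have "\<dots> \<le> m n * (norm (y n - p) + \<delta>) + (1 - m n) * (norm (y n - p) + \<delta>)"
    using m_pos[of n] m_less_1[of n] \<delta> norm_S_diff_approx_le[OF p, of n]
    by (intro add_mono mult_left_mono) auto
  also have "\<dots> = norm (y n - p) + \<delta>"
    by (simp add: algebra_simps)
  finally show ?case
    using Suc by (simp add: algebra_simps)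
qed (use assms in simp)

text \<open>The coefficient of \<delta> depends on \<open>b\<close> and the horizon \<open>N\<close>
  alone, not on \<open>p\<close>; so it stays fixed while \<open>p\<close> varies with
  \<delta>.\<close>

lemma norm_S_diff_approx_square_le:
  fixes N :: nat and b \<delta> :: real
  assumes p: "p \<in> C" "norm (p - S p) \<le> \<delta>" and "norm (x - p) \<le> b" and "\<delta> \<le> 1" and "n \<le> N"
  shows "(norm (S (y n) - p))\<^sup>2 \<le> (norm (y n - p))\<^sup>2 + (2 * (b + N) + 1) * \<delta>"
proof -
  have \<delta>: "0 \<le> \<delta>"
    using p(2) norm_ge_zero order_trans by blast
  have "real n * \<delta> \<le> real N * 1"
    using \<open>n \<le> N\<close> \<open>\<delta> \<le> 1\<close> \<delta> by (intro mult_mono) auto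
  then have *: "norm (y n - p) \<le> b + N"
    using norm_diff_approx_le[OF assms(1-3), of n] by simp
  have "(norm (S (y n) - p))\<^sup>2 \<le> (norm (y n - p) + \<delta>)\<^sup>2"
    using norm_S_diff_approx_le[OF p] by (intro power_mono) auto
  also have "\<dots> = (norm (y n - p))\<^sup>2 + (2 * norm (y n - p) + \<delta>) * \<delta>"
    by (simp add: power2_eq_square algebra_simps)
  also have "\<dots> \<le> (norm (y n - p))\<^sup>2 + (2 * (b + N) + 1) * \<delta>"
    using * \<delta> \<open>\<delta> \<le> 1\<close> by (intro add_left_mono mult_right_mono) auto
  finally show ?thesis .
qed

text \<open>The identity for squared norms of affine combinations makes step \<open>k\<close> lower
  the squared distance by \<open>weight k * (norm (residual k))\<^sup>2\<close>, up to an error that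
  the horizon \<open>N\<close> makes uniform over the steps.\<close>

lemma descent:
  fixes N :: nat and b \<delta> :: real
  assumes "p \<in> C" "norm (p - S p) \<le> \<delta>" "norm (x - p) \<le> b" "\<delta> \<le> 1" and "n \<le> N"
  shows "(norm (y n - p))\<^sup>2 + (\<Sum>k<n. weight k * (norm (residual k))\<^sup>2)
    \<le> b\<^sup>2 + n * (2 * (b + N) + 1) * \<delta>"
  using \<open>n \<le> N\<close>
proof (induction n)
  case 0
  then show ?case
    using assms(3) by (simp add: power_mono)
next
  case (Suc n)
  let ?E = "(2 * (b + N) + 1) * \<delta>"
  have "0 \<le> b" "0 \<le> \<delta>"
    using assms(2,3) norm_ge_zero order_trans by blast+
  then have E: "0 \<le> ?E"
    by (intro mult_nonneg_nonneg) auto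
  have "y (Suc n) - p = m n *\<^sub>R (y n - p) + (1 - m n) *\<^sub>R (S (y n) - p)"
    by (simp add: algebra_simps)
  then have "(norm (y (Suc n) - p))\<^sup>2 = m n * (norm (y n - p))\<^sup>2
      + (1 - m n) * (norm (S (y n) - p))\<^sup>2 - weight n * (norm (residual n))\<^sup>2"
    by (simp only: norm_affine_combination_square) simp
  also have "\<dots> \<le> m n * ((norm (y n - p))\<^sup>2 + ?E) + (1 - m n) * ((norm (y n - p))\<^sup>2 + ?E)
      - weight n * (norm (residual n))\<^sup>2"
    using Suc.prems m_pos[of n] m_less_1[of n] E norm_S_diff_approx_square_le[OF assms(1-4), of n N]
    by (intro diff_right_mono add_mono mult_left_mono) auto
  also have "\<dots> = (norm (y n - p))\<^sup>2 + ?E - weight n * (norm (residual n))\<^sup>2"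
    by (simp add: algebra_simps)
  finally show ?case
    using Suc by (simp add: algebra_simps)
qed

section \<open>Weighted sums of residuals and strictness\<close>

lemma sum_weighted_residuals_le:
  assumes "has_approx_fixed_points C S x b"
  shows "(\<Sum>k<n. weight k * (norm (residual k))\<^sup>2) \<le> b\<^sup>2"
proof (rule le_if_le_plus_small_multiples)
  fix \<delta> :: real
  assume \<delta>: "0 < \<delta>" "\<delta> \<le> 1"
  obtain p where p: "p \<in> C" "norm (x - p) \<le> b" "norm (p - S p) < \<delta>"
    using assms \<delta> unfolding has_approx_fixed_points_def by blast
  have "(norm (y n - p))\<^sup>2 + (\<Sum>k<n. weight k * (norm (residual k))\<^sup>2)
      \<le> b\<^sup>2 + n * (2 * (b + n) + 1) * \<delta>"
    using p \<delta> by (intro descent) auto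
  then show "(\<Sum>k<n. weight k * (norm (residual k))\<^sup>2) \<le> b\<^sup>2 + (n * (2 * (b + n) + 1)) * \<delta>"
    using zero_le_power2[of "norm (y n - p)"] by linarith
qed

text \<open>When two consecutive residuals equal \<open>v\<close>, the distance from
  \<open>y n\<close> to \<open>p\<close> cannot be small: up to multiples of \<delta>, its square is
  at least \<open>1 / 4 + \<mu> * (1 + \<mu>)\<close> times that of \<open>norm v\<close>, where
  \<mu> is \<open>1 - m n\<close>. Keeping this term in \<open>descent\<close> gives the
  gain.\<close>

lemma sum_plus_gain_le:
  assumes apx: "has_approx_fixed_points C S x b" and eq: "residual (Suc n) = residual n"
  shows "(\<Sum>k<n. weight k * (norm (residual k))\<^sup>2)
    + (1 / 4 + (1 - m n) * (2 - m n)) * (norm (residual n))\<^sup>2 \<le> b\<^sup>2"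
proof (rule le_if_le_plus_small_multiples)
  fix \<delta> :: real
  assume \<delta>: "0 < \<delta>" "\<delta> \<le> 1"
  obtain p where p: "p \<in> C" "norm (x - p) \<le> b" "norm (p - S p) < \<delta>"
    using apx \<delta> unfolding has_approx_fixed_points_def by blast
  define w where "w = y (Suc n) - p"
  define v where "v = residual n"
  define E where "E = 2 * (b + Suc n) + 1"
  define \<mu> where "\<mu> = 1 - m n"
  have \<mu>: "0 < \<mu>" "\<mu> < 1"
    using m_pos[of n] m_less_1[of n] by (auto simp: \<mu>_def)
  have "0 \<le> b"
    using p(2) norm_ge_zero order_trans by blast
  then have E: "0 \<le> E"
    by (simp add: E_def)
  \<comment> \<open>The equality of residuals enters here: \<open>v\<close> is also the residual at
    \<open>Suc n\<close>.\<close>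
  have wv: "w - v = S (y (Suc n)) - p"
    unfolding w_def v_def eq[symmetric] by (simp del: mann.simps)
  have wv2: "(norm (w - v))\<^sup>2 \<le> (norm w)\<^sup>2 + E * \<delta>"
    unfolding wv using norm_S_diff_approx_square_le[OF p(1) less_imp_le[OF p(3)] p(2) \<delta>(2) order_refl, of "Suc n"]
    by (simp add: w_def E_def)
  have expand: "(norm (w - v))\<^sup>2 = (norm w)\<^sup>2 - 2 * (w \<bullet> v) + (norm v)\<^sup>2"
    unfolding power2_norm_eq_inner
    by (simp add: inner_diff_left inner_diff_right inner_commute)
  have inner: "(norm v)\<^sup>2 - E * \<delta> \<le> 2 * (w \<bullet> v)"
    using wv2 expand by simp
  \<comment> \<open>The parallelogram law: \<open>w\<close> and \<open>w - v\<close> differ by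
    \<open>v\<close>, and the second is hardly longer than the first, so \<open>w\<close> has at
    least about half the length of \<open>v\<close>.\<close>
  have "0 \<le> (norm (2 *\<^sub>R w - v))\<^sup>2"
    by simp
  also have par: "(norm (2 *\<^sub>R w - v))\<^sup>2 = 2 * (norm w)\<^sup>2 + 2 * (norm (w - v))\<^sup>2 - (norm v)\<^sup>2"
    unfolding power2_norm_eq_inner
    by (simp add: inner_diff_left inner_diff_right inner_commute)
  finally have w2: "(norm v)\<^sup>2 / 4 - E * \<delta> / 2 \<le> (norm w)\<^sup>2"
    using wv2 by simp
  have "y n - p = w + \<mu> *\<^sub>R v"
    unfolding w_def v_def \<mu>_def y_diff_Suc[symmetric] by (simp del: mann.simps)
  then have "(norm (y n - p))\<^sup>2 = (norm w)\<^sup>2 + \<mu> * (2 * (w \<bullet> v)) + \<mu>\<^sup>2 * (norm v)\<^sup>2"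
    unfolding power2_norm_eq_inner
    by (simp add: inner_add_left inner_add_right inner_commute algebra_simps power2_eq_square)
  also have "\<dots> \<ge> (norm v)\<^sup>2 / 4 - E * \<delta> / 2 + \<mu> * ((norm v)\<^sup>2 - E * \<delta>) + \<mu>\<^sup>2 * (norm v)\<^sup>2"
    using w2 inner \<mu> by (intro add_mono mult_left_mono) auto
  finally have "(1 / 4 + \<mu> * (1 + \<mu>)) * (norm v)\<^sup>2 - E * \<delta> / 2 - \<mu> * (E * \<delta>) \<le> (norm (y n - p))\<^sup>2"
    by (simp add: algebra_simps power2_eq_square)
  moreover have "\<mu> * (E * \<delta>) \<le> E * \<delta>"
    using \<mu> E \<delta> by (intro mult_left_le_one_le) auto
  moreover have "(norm (y n - p))\<^sup>2 + (\<Sum>k<n. weight k * (norm (residual k))\<^sup>2)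
      \<le> b\<^sup>2 + n * (2 * (b + Suc n) + 1) * \<delta>"
    using p \<delta> by (intro descent) auto
  \<comment> \<open>The error \<open>3 / 2 * E\<close> combines one half from the bound on
    \<open>w\<close> with at most one from the inner product, as \<mu> is below 1.\<close>
  ultimately have "(\<Sum>k<n. weight k * (norm (residual k))\<^sup>2) + (1 / 4 + \<mu> * (1 + \<mu>)) * (norm v)\<^sup>2
      \<le> b\<^sup>2 + (n * E + 3 / 2 * E) * \<delta>"
    unfolding E_def[symmetric] by (simp add: algebra_simps)
  then show "(\<Sum>k<n. weight k * (norm (residual k))\<^sup>2)
      + (1 / 4 + (1 - m n) * (2 - m n)) * (norm (residual n))\<^sup>2
      \<le> b\<^sup>2 + (n * (2 * (b + Suc n) + 1) + 3 / 2 * (2 * (b + Suc n) + 1)) * \<delta>"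
    unfolding v_def \<mu>_def E_def by simp
qed

text \<open>Monotonicity allows every residual in the sum to be replaced by the last one. Strictness
  comes from a strict drop in the last step or, failing that, from
  \<open>sum_plus_gain_le\<close>.\<close>

lemma sum_weights_residual_less:
  assumes apx: "has_approx_fixed_points C S x b" and "0 < b" and x: "norm (x - S x) \<le> b"
    and pos: "0 < norm (residual n)"
  shows "(\<Sum>k\<le>n. weight k) * (norm (residual n))\<^sup>2 < b\<^sup>2"
proof (cases n)
  case 0
  \<comment> \<open>There is no previous residual to compare with; the slack comes from the weight
    being at most \<open>1 / 4\<close>.\<close>
  have "weight 0 * (norm (x - S x))\<^sup>2 \<le> 1 / 4 * b\<^sup>2"
    using weight_le_quarter[of 0] x \<open>0 < b\<close> by (intro mult_mono power_mono) auto
  also have "\<dots> < b\<^sup>2"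
    using \<open>0 < b\<close> by simp
  finally show ?thesis
    by (simp add: 0)
next
  case (Suc n')
  let ?s = "norm (residual n)"
  have sq_le: "?s\<^sup>2 \<le> (norm (residual k))\<^sup>2" if "k \<le> n" for k
    using norm_residual_antimono[OF that] by (intro power_mono) auto
  show ?thesis
  proof (cases "norm (residual n) = norm (residual n')")
    case False
    then have less: "?s < norm (residual n')"
      using norm_residual_Suc_le[of n'] unfolding Suc by simp
    have "(\<Sum>k\<le>n. weight k) * ?s\<^sup>2 = (\<Sum>k<Suc n. weight k * ?s\<^sup>2)"
      by (simp only: sum_distrib_right lessThan_Suc_atMost)
    also have "\<dots> < (\<Sum>k<Suc n. weight k * (norm (residual k))\<^sup>2)"
    proof (rule sum_strict_mono_ex1)
      show "\<forall>k\<in>{..<Suc n}. weight k * ?s\<^sup>2 \<le> weight k * (norm (residual k))\<^sup>2"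
        using sq_le weight_pos by (intro ballI mult_left_mono) (auto simp: less_imp_le)
      show "\<exists>k\<in>{..<Suc n}. weight k * ?s\<^sup>2 < weight k * (norm (residual k))\<^sup>2"
        using less weight_pos[of n'] Suc
        by (intro bexI[of _ n'] mult_strict_left_mono power_strict_mono) auto
    qed simp
    also have "\<dots> \<le> b\<^sup>2"
      by (rule sum_weighted_residuals_le[OF apx])
    finally show ?thesis .
  next
    case True
    then have eq: "residual (Suc n') = residual n'"
      unfolding Suc by (rule residual_Suc_eq)
    \<comment> \<open>The gain strictly exceeds the last two weights, which the sum over
      \<open>k < n'\<close> leaves out.\<close>
    have "weight n' + weight n < 1 / 4 + (1 - m n') * (2 - m n')"
    proof -
      have "m n' * (1 - m n') < (2 - m n') * (1 - m n')"
        using m_less_1[of n'] by (intro mult_strict_right_mono) auto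
      then show ?thesis
        using weight_le_quarter[of n] by (simp add: mult.commute)
    qed
    then have "(weight n' + weight n) * ?s\<^sup>2 < (1 / 4 + (1 - m n') * (2 - m n')) * ?s\<^sup>2"
      using pos by (intro mult_strict_right_mono) auto
    moreover have "(\<Sum>k<n'. weight k * ?s\<^sup>2) \<le> (\<Sum>k<n'. weight k * (norm (residual k))\<^sup>2)"
      using Suc by (intro sum_mono mult_left_mono sq_le less_imp_le[OF weight_pos]) simp
    moreover have "(\<Sum>k\<le>n. weight k) * ?s\<^sup>2
        = (\<Sum>k<n'. weight k * ?s\<^sup>2) + (weight n' + weight n) * ?s\<^sup>2"
      by (simp add: Suc lessThan_Suc_atMost[symmetric] sum_distrib_right distrib_right
          del: mann.simps)
    ultimately show ?thesis
      using sum_plus_gain_le[OF apx eq] unfolding True by linarith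
  qed
qed

end

section \<open>Reduction of strict pseudo-contractions to nonexpansive maps\<close>

definition averaged :: "real \<Rightarrow> ('a::real_vector \<Rightarrow> 'a) \<Rightarrow> 'a \<Rightarrow> 'a" where
  "averaged \<kappa> T u = \<kappa> *\<^sub>R u + (1 - \<kappa>) *\<^sub>R T u"

lemma averaged_residual: "u - averaged \<kappa> T u = (1 - \<kappa>) *\<^sub>R (u - T u)"
  by (simp add: averaged_def algebra_simps)

text \<open>The extra term allowed by strict pseudo-contractivity, scaled by
  \<open>1 - \<kappa>\<close>, is exactly the term subtracted in
  \<open>norm_affine_combination_square\<close>.\<close>

lemma averaged_nonexpansive:
  assumes "strict_pseudo_contraction \<kappa> C T" "u \<in> C" "v \<in> C"
  shows "norm (averaged \<kappa> T u - averaged \<kappa> T v) \<le> norm (u - v)"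
proof (rule power2_le_imp_le)
  have \<kappa>: "0 \<le> \<kappa>" "\<kappa> < 1"
    and T: "(norm (T u - T v))\<^sup>2 \<le> (norm (u - v))\<^sup>2 + \<kappa> * (norm (u - T u - (v - T v)))\<^sup>2"
    using assms unfolding strict_pseudo_contraction_def by auto
  have d: "u - v - (T u - T v) = u - T u - (v - T v)"
    by simp
  have "averaged \<kappa> T u - averaged \<kappa> T v = \<kappa> *\<^sub>R (u - v) + (1 - \<kappa>) *\<^sub>R (T u - T v)"
    by (simp add: averaged_def algebra_simps)
  then have "(norm (averaged \<kappa> T u - averaged \<kappa> T v))\<^sup>2 = \<kappa> * (norm (u - v))\<^sup>2
      + (1 - \<kappa>) * (norm (T u - T v))\<^sup>2 - \<kappa> * (1 - \<kappa>) * (norm (u - T u - (v - T v)))\<^sup>2"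
    by (simp only: norm_affine_combination_square d)
  also have "\<dots> \<le> \<kappa> * (norm (u - v))\<^sup>2
      + (1 - \<kappa>) * ((norm (u - v))\<^sup>2 + \<kappa> * (norm (u - T u - (v - T v)))\<^sup>2)
      - \<kappa> * (1 - \<kappa>) * (norm (u - T u - (v - T v)))\<^sup>2"
    using T \<kappa> by (intro diff_right_mono add_left_mono mult_left_mono) auto
  also have "\<dots> = (norm (u - v))\<^sup>2"
    by (simp add: algebra_simps)
  finally show "(norm (averaged \<kappa> T u - averaged \<kappa> T v))\<^sup>2 \<le> (norm (u - v))\<^sup>2" .
qed simp

text \<open>Both iterations subtract a multiple of \<open>u - T u\<close> from \<open>u\<close>, and
  the weights are chosen so that the multiples agree.\<close>

lemma mann_averaged:
  assumes "\<kappa> < 1"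
  shows "mann (averaged \<kappa> T) (\<lambda>n. (l n - \<kappa>) / (1 - \<kappa>)) x n = mann T l x n"
proof (induction n)
  case (Suc n)
  let ?m = "(l n - \<kappa>) / (1 - \<kappa>)"
  have c: "(1 - ?m) * (1 - \<kappa>) = 1 - l n"
    using assms by (simp add: field_simps)
  have "?m *\<^sub>R u + (1 - ?m) *\<^sub>R averaged \<kappa> T u = l n *\<^sub>R u + (1 - l n) *\<^sub>R T u" for u
  proof -
    have "?m *\<^sub>R u + (1 - ?m) *\<^sub>R averaged \<kappa> T u = u - (1 - ?m) *\<^sub>R (u - averaged \<kappa> T u)"
      by (simp only: scaleR_diff_left scaleR_diff_right scaleR_one) simp
    also have "\<dots> = u - (1 - l n) *\<^sub>R (u - T u)"
      by (simp only: averaged_residual scaleR_scaleR c)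
    also have "\<dots> = l n *\<^sub>R u + (1 - l n) *\<^sub>R T u"
      by (simp only: scaleR_diff_left scaleR_diff_right scaleR_one) simp
    finally show ?thesis .
  qed
  then show ?case
    by (simp only: mann.simps Suc)
qed simp

theorem theorem2p1:
  fixes C :: "'a::{real_inner,complete_space} set"
    and T :: "'a \<Rightarrow> 'a"
    and \<kappa> b :: real
    and l :: "nat \<Rightarrow> real"
    and \<theta> :: "nat \<Rightarrow> nat"
    and x :: 'a
  assumes "C \<noteq> {}" and "convex C"
    and "0 \<le> \<kappa>" and "\<kappa> < 1"
    and "strict_pseudo_contraction \<kappa> C T"
    and "\<And>n. l n \<in> {\<kappa><..<1}"
    and "filterlim (\<lambda>n. \<Sum>k<n. (l k - \<kappa>) * (1 - l k)) at_top sequentially"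
    and "rate_of_divergence (\<lambda>n. (l n - \<kappa>) * (1 - l n)) \<theta>"
    and "x \<in> C" and "b > 0"
    and "norm (x - T x) \<le> b"
    and "has_approx_fixed_points C T x b"
  shows "(\<lambda>n. norm (mann T l x n - T (mann T l x n))) \<longlonglongrightarrow> 0 \<and>
         (\<forall>\<epsilon>>0. \<forall>n\<ge>Phi \<epsilon> b \<theta>. norm (mann T l x n - T (mann T l x n)) < \<epsilon>)"
proof -
  define S where "S = averaged \<kappa> T"
  define m where "m n = (l n - \<kappa>) / (1 - \<kappa>)" for n
  define r where "r n = norm (mann T l x n - T (mann T l x n))" for n
  have T_in: "T u \<in> C" if "u \<in> C" for u
    using assms(5) that unfolding strict_pseudo_contraction_def by auto
  interpret nonexpansive_mann C S m x
  proof
    show "S u \<in> C" if "u \<in> C" for u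
      unfolding S_def averaged_def
      using convexD[OF \<open>convex C\<close> that T_in[OF that], of \<kappa> "1 - \<kappa>"] assms(3,4) by simp
    show "norm (S u - S v) \<le> norm (u - v)" if "u \<in> C" "v \<in> C" for u v
      unfolding S_def using averaged_nonexpansive[OF assms(5) that] .
    show "0 < m n" "m n < 1" for n
      using assms(4) assms(6)[of n] by (auto simp: m_def)
  qed (use assms in auto)
  have norm_S: "norm (u - S u) = (1 - \<kappa>) * norm (u - T u)" for u
    using \<open>\<kappa> < 1\<close> unfolding S_def averaged_residual by simp
  have norm_S_le: "norm (u - S u) \<le> norm (u - T u)" for u
    unfolding norm_S using assms(3,4) by (intro mult_left_le_one_le) auto
  have "mann S m x n = mann T l x n" for n
    using mann_averaged[OF \<open>\<kappa> < 1\<close>] unfolding S_def m_def .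
  then have norm_residual: "norm (residual n) = (1 - \<kappa>) * r n" for n
    unfolding r_def by (simp only: norm_S)
  \<comment> \<open>The residuals of \<open>S\<close> are no larger than those of \<open>T\<close>,
    so the same points serve with the same \<open>b\<close>.\<close>
  have apx: "has_approx_fixed_points C S x b"
    using assms(12) norm_S_le unfolding has_approx_fixed_points_def by (meson order_le_less_trans)
  \<comment> \<open>The factor \<open>(1 - \<kappa>)\<^sup>2\<close> cancels against the one in the
    squared residuals of \<open>S\<close>, so \<theta> applies without rescaling.\<close>
  have weight: "weight k * (1 - \<kappa>)\<^sup>2 = (l k - \<kappa>) * (1 - l k)" for k
  proof -
    have "m k * (1 - \<kappa>) = l k - \<kappa>" "(1 - m k) * (1 - \<kappa>) = 1 - l k"
      using \<open>\<kappa> < 1\<close> by (simp_all add: m_def field_simps)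
    then show ?thesis
      by (metis mult.assoc mult.left_commute power2_eq_square)
  qed
  have rate: "r n < \<epsilon>" if "0 < \<epsilon>" and n: "Phi \<epsilon> b \<theta> \<le> n" for \<epsilon> n
  proof (rule ccontr)
    define N where "N = Phi \<epsilon> b \<theta>"
    assume "\<not> r n < \<epsilon>"
    \<comment> \<open>Monotonicity moves a violation at \<open>n\<close> back to the threshold
      \<open>N\<close>, where the sum of weights is at least
      \<open>b\<^sup>2 / \<epsilon>\<^sup>2\<close>. This contradicts the strict bound by
      \<open>b\<^sup>2\<close>.\<close>
    moreover have "r n \<le> r N"
      using norm_residual_antimono[OF n] \<open>\<kappa> < 1\<close> unfolding norm_residual N_def by simp
    ultimately have rN: "\<epsilon> \<le> r N"
      by simp
    have "b\<^sup>2 / \<epsilon>\<^sup>2 \<le> nat \<lceil>b\<^sup>2 / \<epsilon>\<^sup>2\<rceil>"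
      by (rule real_nat_ceiling_ge)
    also have "\<dots> \<le> (\<Sum>k\<le>N. (l k - \<kappa>) * (1 - l k))"
      using assms(8) unfolding rate_of_divergence_def N_def Phi_def atLeast0AtMost by blast
    finally have A: "b\<^sup>2 / \<epsilon>\<^sup>2 \<le> (\<Sum>k\<le>N. (l k - \<kappa>) * (1 - l k))" .
    have "b\<^sup>2 = b\<^sup>2 / \<epsilon>\<^sup>2 * \<epsilon>\<^sup>2"
      using \<open>0 < \<epsilon>\<close> by simp
    also have "\<dots> \<le> (\<Sum>k\<le>N. (l k - \<kappa>) * (1 - l k)) * (r N)\<^sup>2"
      using A rN \<open>0 < \<epsilon>\<close> by (intro mult_mono power_mono order_trans[OF _ A]) auto
    also have "\<dots> = (\<Sum>k\<le>N. weight k) * (norm (residual N))\<^sup>2"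
      unfolding norm_residual power_mult_distrib weight[symmetric] sum_distrib_right[symmetric]
      by (simp only: mult.assoc)
    also have "\<dots> < b\<^sup>2"
    proof (rule sum_weights_residual_less[OF apx \<open>b > 0\<close>])
      show "norm (x - S x) \<le> b"
        using norm_S_le assms(11) by (rule order_trans)
      show "0 < norm (residual N)"
        unfolding norm_residual using \<open>\<kappa> < 1\<close> rN \<open>0 < \<epsilon>\<close> by simp
    qed
    finally show False
      by simp
  qed
  have "r \<longlonglongrightarrow> 0"
  proof (rule LIMSEQ_I)
    fix \<epsilon> :: real
    assume "0 < \<epsilon>"
    moreover have "0 \<le> r n" for n
      by (simp add: r_def)
    ultimately show "\<exists>n0. \<forall>n\<ge>n0. norm (r n - 0) < \<epsilon>"
      using rate by auto
  qed
  with rate show ?thesis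
    unfolding r_def by blast
qed

end
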